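(* Let $\Gamma$ be an uncountable set and let $A(\Gamma)=\Gamma\cup\{\infty\}$ be the one-point compactification of $\Gamma$ equipped with the discrete topology. Then $A(\Gamma)$ does not admit a closeness function. Hence, it does not admit a $B_{\mathcal{M}(A(\Gamma))}$-compensation function either.
   Context: For a compact Hausdorff space $K$, $\mathcal{M}(K)=C(K)^*$ is the space of regular Borel signed (real) measures on $K$ with the total variation norm, $B_{\mathcal{M}(K)}$ is its closed unit ball, $\omega^*$ its weak$^*$ topology, and $\mu^+$ is the positive part of $\mu\in\mathcal{M}(K)$. A closeness function for $K$ is a continuous function $c\colon\{(x,y,z)\in K^3\colon y\ne z\}\to[-1,1]$ such that (i) $c(x,y,z)=-c(x,z,y)$ whenever $y\neq z$; (ii) $c(x,x,z)=1$ whenever $x\ne z$. $\nu\in\mathcal{M}(K)$ is a compensation of $\mu\in\mathcal{M}(K)$ if: $0\le\nu\le\mu^+$ and $\nu(K)=\mu(K)$ in case $\mu(K)>0$; and $\nu=0$ in case $\mu(K)\le 0$. A $B_{\mathcal{M}(K)}$-compensation function is an $\omega^*$-$\omega^*$-continuous map $\xi\colon B_{\mathcal{M}(K)}\to\mathcal{M}(K)$ such that $\xi(\mu)$ is a compensation of $\mu$ for every $\mu\in B_{\mathcal{M}(K)}$. *)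

theory Defs
  imports "HOL-Analysis.Analysis"
begin

text \<open>The domain is the space of triples \<open>(x, y, z)\<close> of points of \<open>K\<close> with \<open>y \<noteq> z\<close>,
  with the topology inherited from the product.\<close>

definition closeness_function :: "'a topology \<Rightarrow> ('a \<times> 'a \<times> 'a \<Rightarrow> real) \<Rightarrow> bool" where
  "closeness_function K c \<longleftrightarrow>
     continuous_map (subtopology (prod_topology K (prod_topology K K)) {(x, y, z). y \<noteq> z})
       (top_of_set {-1..1}) c \<and>
     (\<forall>x\<in>topspace K. \<forall>y\<in>topspace K. \<forall>z\<in>topspace K. y \<noteq> z \<longrightarrow> c (x, y, z) = - c (x, z, y)) \<and>
     (\<forall>x\<in>topspace K. \<forall>z\<in>topspace K. x \<noteq> z \<longrightarrow> c (x, x, z) = 1)"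

definition borel_sets :: "'a topology \<Rightarrow> 'a set set" where
  "borel_sets K = sigma_sets (topspace K) {U. openin K U}"

text \<open>A signed measure is a countably additive real-valued set function on the Borel sets. As a
  total function it takes the value \<open>0\<close> off the Borel sets, so that equality of functions is
  equality of measures.\<close>

definition signed_measure :: "'a topology \<Rightarrow> ('a set \<Rightarrow> real) \<Rightarrow> bool" where
  "signed_measure K \<mu> \<longleftrightarrow>
     \<mu> {} = 0 \<and>
     (\<forall>A :: nat \<Rightarrow> 'a set. range A \<subseteq> borel_sets K \<longrightarrow> disjoint_family A \<longrightarrow>
        (\<lambda>n. \<mu> (A n)) sums \<mu> (\<Union>n. A n)) \<and>
     (\<forall>A. A \<notin> borel_sets K \<longrightarrow> \<mu> A = 0)"

text \<open>The positive part in the sense of the Jordan decomposition. A signed measure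
  is bounded, so the supremum below is over a nonempty set that is bounded above.\<close>

definition positive_part :: "'a topology \<Rightarrow> ('a set \<Rightarrow> real) \<Rightarrow> 'a set \<Rightarrow> real" where
  "positive_part K \<mu> A =
     (if A \<in> borel_sets K then SUP B\<in>{B \<in> borel_sets K. B \<subseteq> A}. \<mu> B else 0)"

definition negative_part :: "'a topology \<Rightarrow> ('a set \<Rightarrow> real) \<Rightarrow> 'a set \<Rightarrow> real" where
  "negative_part K \<mu> = positive_part K (\<lambda>A. - \<mu> A)"

definition total_variation :: "'a topology \<Rightarrow> ('a set \<Rightarrow> real) \<Rightarrow> 'a set \<Rightarrow> real" where
  "total_variation K \<mu> A = positive_part K \<mu> A + negative_part K \<mu> A"

definition regular_measures :: "'a topology \<Rightarrow> ('a set \<Rightarrow> real) set" where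
  "regular_measures K =
     {\<mu>. signed_measure K \<mu> \<and>
         (\<forall>A\<in>borel_sets K. \<forall>e>0. \<exists>C U. closedin K C \<and> openin K U \<and> C \<subseteq> A \<and> A \<subseteq> U \<and>
            total_variation K \<mu> (U - C) < e)}"

definition measures_unit_ball :: "'a topology \<Rightarrow> ('a set \<Rightarrow> real) set" where
  "measures_unit_ball K = {\<mu> \<in> regular_measures K. total_variation K \<mu> (topspace K) \<le> 1}"

definition signed_integral :: "'a topology \<Rightarrow> ('a set \<Rightarrow> real) \<Rightarrow> ('a \<Rightarrow> real) \<Rightarrow> real" where
  "signed_integral K \<mu> f =
     integral\<^sup>L (measure_of (topspace K) (borel_sets K) (\<lambda>A. ennreal (positive_part K \<mu> A))) f
   - integral\<^sup>L (measure_of (topspace K) (borel_sets K) (\<lambda>A. ennreal (negative_part K \<mu> A))) f"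

text \<open>The coarsest topology on the regular measures making \<open>\<mu> \<mapsto> \<integral> f d\<mu>\<close> continuous for every
  continuous real function \<open>f\<close> on \<open>K\<close>.\<close>

definition weak_star :: "'a topology \<Rightarrow> ('a set \<Rightarrow> real) topology" where
  "weak_star K =
     pullback_topology (regular_measures K)
       (\<lambda>\<mu>. \<lambda>f\<in>{f. continuous_map K euclideanreal f}. signed_integral K \<mu> f)
       (product_topology (\<lambda>_. euclideanreal) {f. continuous_map K euclideanreal f})"

lemma topspace_weak_star: "topspace (weak_star K) = regular_measures K"
  by (auto simp: weak_star_def topspace_pullback_topology)

definition compensation_of ::
    "'a topology \<Rightarrow> ('a set \<Rightarrow> real) \<Rightarrow> ('a set \<Rightarrow> real) \<Rightarrow> bool" where
  "compensation_of K \<mu> \<nu> \<longleftrightarrow>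
     \<nu> \<in> regular_measures K \<and>
     (if \<mu> (topspace K) > 0
      then (\<forall>A\<in>borel_sets K. 0 \<le> \<nu> A \<and> \<nu> A \<le> positive_part K \<mu> A) \<and>
           \<nu> (topspace K) = \<mu> (topspace K)
      else \<nu> = (\<lambda>_. 0))"

definition ball_compensation_function ::
    "'a topology \<Rightarrow> (('a set \<Rightarrow> real) \<Rightarrow> ('a set \<Rightarrow> real)) \<Rightarrow> bool" where
  "ball_compensation_function K \<xi> \<longleftrightarrow>
     continuous_map (subtopology (weak_star K) (measures_unit_ball K)) (weak_star K) \<xi> \<and>
     (\<forall>\<mu>\<in>measures_unit_ball K. compensation_of K \<mu> (\<xi> \<mu>))"

end

theory Submission
  imports Defs
begin

text \<open>If every \<open>y \<in> \<Gamma>\<close> has a neighbourhood \<open>U y\<close> of \<open>\<infinity>\<close>, then, as each \<open>U y\<close> is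
  cofinite and \<open>\<Gamma>\<close> is uncountable, there are \<open>y \<noteq> z\<close> with \<open>z \<in> U y\<close> and \<open>y \<in> U z\<close>. A closeness
  function has \<open>c (\<infinity>, y, z) \<rightarrow> c (\<infinity>, y, \<infinity>) = - 1\<close> as \<open>z \<rightarrow> \<infinity>\<close>, so that both \<open>c (\<infinity>, y, z)\<close> and
  \<open>c (\<infinity>, z, y)\<close> would be negative for some such pair, against antisymmetry.

  For a compensation function \<open>\<xi>\<close>, consider \<open>\<mu> = (\<delta>\<^sub>y + \<delta>\<^sub>z - \<delta>\<^sub>\<infinity>) / 3\<close>. If \<open>y \<noteq> z\<close>, then \<open>\<xi> \<mu>\<close> is
  a positive measure of mass \<open>1/3\<close> on \<open>{y, z}\<close>. As \<open>z \<rightarrow> \<infinity>\<close>, \<open>\<mu>\<close> converges to \<open>\<delta>\<^sub>y / 3\<close>, whose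
  only compensation is itself, so that \<open>\<xi> \<mu> {y} \<rightarrow> 1/3\<close>. Hence both \<open>\<xi> \<mu> {y}\<close> and \<open>\<xi> \<mu> {z}\<close>
  would exceed \<open>1/6\<close> for some pair, against the total mass.\<close>

subsection \<open>Neighbourhoods of infinity\<close>

text \<open>A countable infinite \<open>D\<close> together with all \<open>F y\<close> for
  \<open>y\<close> in \<open>D\<close> is still countable, so some \<open>z\<close> in
  \<open>\<Gamma>\<close> lies outside. This \<open>z\<close> avoids \<open>F y\<close> for every
  \<open>y\<close> in \<open>D\<close>, while the finite set \<open>F z\<close> cannot cover
  \<open>D\<close>.\<close>

lemma uncountable_mutually_avoiding_pair:
  assumes "uncountable \<Gamma>" and fin: "\<And>y. y \<in> \<Gamma> \<Longrightarrow> finite (F y)"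
  obtains y z where "y \<in> \<Gamma>" "z \<in> \<Gamma>" "y \<noteq> z" "z \<notin> F y" "y \<notin> F z"
proof -
  have "infinite \<Gamma>"
    using assms(1) countable_finite by blast
  then obtain D where D: "D \<subseteq> \<Gamma>" "countable D" "infinite D"
    using infinite_countable_subset' by blast
  have "countable (D \<union> (\<Union>y\<in>D. F y))"
    using D fin by (blast intro: countable_finite)
  then obtain z where z: "z \<in> \<Gamma>" "z \<notin> D \<union> (\<Union>y\<in>D. F y)"
    using assms(1) by (meson countable_subset subsetI)
  obtain y where "y \<in> D" "y \<notin> F z"
    using D(3) fin[OF z(1)] by (meson finite_subset subsetI)
  with z D that show thesis by blast
qed

text \<open>In this model \<open>None\<close> is the point at infinity, and \<open>Some y\<close> is
  the point \<open>y\<close> of \<open>\<Gamma>\<close>.\<close>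

abbreviation "A_compact \<Gamma> \<equiv> Alexandroff_compactification (discrete_topology \<Gamma>)"

lemma t1_space_A_compact: "t1_space (A_compact \<Gamma>)"
  by (simp add: Hausdorff_imp_t1_space)

lemma finite_avoid_nbhd_infinity:
  assumes "openin (A_compact \<Gamma>) U" "None \<in> U"
  shows "finite {z \<in> \<Gamma>. Some z \<notin> U}"
proof -
  obtain C where "compactin (discrete_topology \<Gamma>) C" "U = insert None (Some ` (\<Gamma> - C))"
    using assms by (auto simp: openin_Alexandroff_compactification)
  then show ?thesis
    by (auto simp: compactin_discrete_topology intro: finite_subset)
qed

lemma nbhds_infinity_mutual_pair:
  assumes "uncountable \<Gamma>" and "\<And>y. y \<in> \<Gamma> \<Longrightarrow> openin (A_compact \<Gamma>) (U y) \<and> None \<in> U y"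
  obtains y z where "y \<in> \<Gamma>" "z \<in> \<Gamma>" "y \<noteq> z" "Some z \<in> U y" "Some y \<in> U z"
proof -
  have "finite {z \<in> \<Gamma>. Some z \<notin> U y}" if "y \<in> \<Gamma>" for y
    using assms(2)[OF that] finite_avoid_nbhd_infinity by blast
  then show thesis
    using uncountable_mutually_avoiding_pair[OF assms(1), of "\<lambda>y. {z \<in> \<Gamma>. Some z \<notin> U y}"] that
    by auto
qed

section \<open>Nonexistence of a closeness function\<close>

lemma no_closeness_function:
  assumes "uncountable \<Gamma>"
  shows "\<not> closeness_function (A_compact \<Gamma>) c"
proof
  assume c: "closeness_function (A_compact \<Gamma>) c"
  let ?K = "A_compact \<Gamma>"
  have t1: "t1_space ?K" by (rule t1_space_A_compact)
  have anti: "c (p, q, r) = - c (p, r, q)"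
    if "p \<in> topspace ?K" "q \<in> topspace ?K" "r \<in> topspace ?K" "q \<noteq> r" for p q r
    using c that unfolding closeness_function_def by blast
  have diag: "c (p, p, r) = 1" if "p \<in> topspace ?K" "r \<in> topspace ?K" "p \<noteq> r" for p r
    using c that unfolding closeness_function_def by blast
  \<comment> \<open>The point \<open>Some y\<close> is removed because \<open>c\<close> is
    controlled only on triples whose last two entries differ. As points are closed, the remaining
    set is open.\<close>
  define U where "U y = {t \<in> topspace ?K - {Some y}. c (None, Some y, t) < 0}" for y
  have U: "openin ?K (U y) \<and> None \<in> U y" if y: "y \<in> \<Gamma>" for y
  proof
    let ?D = "topspace ?K - {Some y}"
    have D: "openin ?K ?D"
      using t1 y by (intro openin_diff openin_topspace closedin_t1_singleton) auto
    have "continuous_map (subtopology ?K ?D)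
        (subtopology (prod_topology ?K (prod_topology ?K ?K)) {(x, y, z). y \<noteq> z})
        (\<lambda>t. (None, Some y, t))"
      using y by (auto simp: continuous_map_in_subtopology continuous_map_pairwise o_def
          intro!: continuous_map_from_subtopology)
    moreover have "continuous_map (subtopology (prod_topology ?K (prod_topology ?K ?K))
        {(x, y, z). y \<noteq> z}) euclideanreal c"
      using c by (auto simp: closeness_function_def continuous_map_in_subtopology)
    ultimately have "continuous_map (subtopology ?K ?D) euclideanreal (\<lambda>t. c (None, Some y, t))"
      using continuous_map_compose[unfolded o_def] by blast
    then have "openin (subtopology ?K ?D)
        {t \<in> topspace (subtopology ?K ?D). c (None, Some y, t) \<in> {..<0}}"
      by (rule openin_continuous_map_preimage) simp
    moreover have "{t \<in> topspace (subtopology ?K ?D). c (None, Some y, t) \<in> {..<0}} = U y"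
      by (auto simp: U_def)
    ultimately show "openin ?K (U y)"
      using D by (metis openin_trans_full)
    have "c (None, Some y, None) = - c (None, None, Some y)"
      by (rule anti) (use y in auto)
    moreover have "c (None, None, Some y) = 1"
      by (rule diag) (use y in auto)
    ultimately show "None \<in> U y"
      by (simp add: U_def)
  qed
  obtain y z where yz: "y \<in> \<Gamma>" "z \<in> \<Gamma>" "y \<noteq> z" "Some z \<in> U y" "Some y \<in> U z"
    using nbhds_infinity_mutual_pair[of \<Gamma> U] assms U by blast
  \<comment> \<open>The choice of the pair makes both values negative, which antisymmetry
    forbids.\<close>
  have "c (None, Some y, Some z) = - c (None, Some z, Some y)"
    by (rule anti) (use yz in auto)
  with yz show False
    by (auto simp: U_def)
qed

subsection \<open>Signed measures with finite support\<close>

lemma sigma_algebra_borel_sets: "sigma_algebra (topspace K) (borel_sets K)"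
  unfolding borel_sets_def by (rule sigma_algebra_sigma_sets) (auto dest: openin_subset)

lemma borel_sets_subset: "A \<in> borel_sets K \<Longrightarrow> A \<subseteq> topspace K"
  using sigma_algebra_borel_sets[of K] by (auto simp: sigma_algebra_iff2)

lemma openin_in_borel_sets: "openin K U \<Longrightarrow> U \<in> borel_sets K"
  by (auto simp: borel_sets_def)

lemma topspace_in_borel_sets [simp]: "topspace K \<in> borel_sets K"
  by (simp add: openin_in_borel_sets)

lemma borel_sets_Diff: "A \<in> borel_sets K \<Longrightarrow> B \<in> borel_sets K \<Longrightarrow> A - B \<in> borel_sets K"
  by (meson algebra_iff_Un ring_of_sets.Diff algebra.axioms(1) sigma_algebra.axioms(1) sigma_algebra_borel_sets)

lemma closedin_in_borel_sets: "closedin K C \<Longrightarrow> C \<in> borel_sets K"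
  using borel_sets_Diff[OF topspace_in_borel_sets openin_in_borel_sets, of K "topspace K - C"]
  by (simp add: closedin_def double_diff)

lemma finite_in_borel_sets:
  "t1_space K \<Longrightarrow> finite S \<Longrightarrow> S \<subseteq> topspace K \<Longrightarrow> S \<in> borel_sets K"
  by (simp add: closedin_in_borel_sets t1_space_closedin_finite)

lemma signed_measure_Un:
  assumes "signed_measure K \<mu>" "A \<in> borel_sets K" "B \<in> borel_sets K" "A \<inter> B = {}"
  shows "\<mu> (A \<union> B) = \<mu> A + \<mu> B"
proof -
  have 0: "\<mu> {} = 0" "{} \<in> borel_sets K"
    using assms(1) by (auto simp: signed_measure_def openin_in_borel_sets)
  have "disjoint_family (binaryset A B)"
    using assms(4) by (auto simp: disjoint_family_on_def binaryset_def)
  moreover have "range (binaryset A B) \<subseteq> borel_sets K"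
    using assms 0 by (simp add: range_binaryset_eq)
  ultimately have "(\<lambda>n. \<mu> (binaryset A B n)) sums \<mu> (A \<union> B)"
    using assms(1) UN_binaryset_eq[of A B] unfolding signed_measure_def by metis
  then show ?thesis
    using binaryset_sums[of \<mu> A B, OF 0(1)] sums_unique2 by blast
qed

text \<open>These are the linear combinations of point masses at points of \<open>S\<close>, where
  some coefficients may be 0. Suprema and integrals then reduce to finite sums, without a Hahn
  decomposition.\<close>

locale finitely_supported =
  fixes K :: "'a topology" and \<mu> :: "'a set \<Rightarrow> real" and S :: "'a set"
  assumes t1: "t1_space K" and sm: "signed_measure K \<mu>"
    and fin: "finite S" and sub: "S \<subseteq> topspace K"
    and vanish: "\<And>A. A \<in> borel_sets K \<Longrightarrow> A \<inter> S = {} \<Longrightarrow> \<mu> A = 0"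
begin

lemma subset_borel: "T \<subseteq> S \<Longrightarrow> T \<in> borel_sets K"
  using finite_in_borel_sets[OF t1] fin sub by (meson finite_subset subset_trans)

lemma measure_subset_support: "T \<subseteq> S \<Longrightarrow> \<mu> T = (\<Sum>s\<in>T. \<mu> {s})"
proof (induction T rule: infinite_finite_induct)
  case (infinite A)
  then show ?case using fin finite_subset by blast
next
  case empty
  then show ?case using sm by (simp add: signed_measure_def)
next
  case (insert s T)
  then have "\<mu> ({s} \<union> T) = \<mu> {s} + \<mu> T"
    by (intro signed_measure_Un[OF sm] subset_borel) auto
  with insert show ?case by simp
qed

lemma measure_eq_sum:
  assumes "A \<in> borel_sets K"
  shows "\<mu> A = (\<Sum>s\<in>A \<inter> S. \<mu> {s})"
proof -
  have B: "A \<inter> S \<in> borel_sets K" by (simp add: subset_borel)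
  have "\<mu> ((A \<inter> S) \<union> (A - A \<inter> S)) = \<mu> (A \<inter> S) + \<mu> (A - A \<inter> S)"
    using assms B by (intro signed_measure_Un[OF sm] borel_sets_Diff) auto
  moreover have "\<mu> (A - A \<inter> S) = 0"
    using assms B by (intro vanish borel_sets_Diff) auto
  moreover have "(A \<inter> S) \<union> (A - A \<inter> S) = A" by blast
  ultimately show ?thesis
    using measure_subset_support[of "A \<inter> S"] by simp
qed

lemma uminus: "finitely_supported K (\<lambda>A. - \<mu> A) S"
  using t1 sm fin sub vanish
  by unfold_locales (auto simp: signed_measure_def intro: sums_minus)

text \<open>The supremum is attained at \<open>?B\<close>, the finite set of the points of
  \<open>A \<inter> S\<close> with positive mass.\<close>

lemma positive_part_eq_sum:
  assumes A: "A \<in> borel_sets K"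
  shows "positive_part K \<mu> A = (\<Sum>s\<in>A \<inter> S. max 0 (\<mu> {s}))"
proof -
  let ?B = "{s \<in> A \<inter> S. 0 < \<mu> {s}}"
  have "\<mu> ?B = (\<Sum>s\<in>?B. \<mu> {s})"
    by (rule measure_subset_support) auto
  also have "\<dots> = (\<Sum>s\<in>A \<inter> S. max 0 (\<mu> {s}))"
    using fin by (intro sum.mono_neutral_cong_left) auto
  finally have eq: "\<mu> ?B = (\<Sum>s\<in>A \<inter> S. max 0 (\<mu> {s}))" .
  have "(SUP B\<in>{B \<in> borel_sets K. B \<subseteq> A}. \<mu> B) = (\<Sum>s\<in>A \<inter> S. max 0 (\<mu> {s}))"
  proof (rule cSup_eq_maximum)
    show "(\<Sum>s\<in>A \<inter> S. max 0 (\<mu> {s})) \<in> \<mu> ` {B \<in> borel_sets K. B \<subseteq> A}"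
      using eq by (intro image_eqI[where x = ?B]) (auto intro: subset_borel)
  next
    fix x assume "x \<in> \<mu> ` {B \<in> borel_sets K. B \<subseteq> A}"
    then obtain B where B: "B \<in> borel_sets K" "B \<subseteq> A" "x = \<mu> B" by blast
    have "\<mu> B \<le> (\<Sum>s\<in>B \<inter> S. max 0 (\<mu> {s}))"
      unfolding measure_eq_sum[OF B(1)] by (intro sum_mono) auto
    also have "\<dots> \<le> (\<Sum>s\<in>A \<inter> S. max 0 (\<mu> {s}))"
      using fin B by (intro sum_mono2) auto
    finally show "x \<le> (\<Sum>s\<in>A \<inter> S. max 0 (\<mu> {s}))"
      using B by simp
  qed
  then show ?thesis
    using A by (simp add: positive_part_def)
qed

lemma negative_part_eq_sum:
  assumes "A \<in> borel_sets K"
  shows "negative_part K \<mu> A = (\<Sum>s\<in>A \<inter> S. max 0 (- \<mu> {s}))"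
  unfolding negative_part_def using finitely_supported.positive_part_eq_sum[OF uminus assms] .

lemma total_variation_eq_sum:
  assumes "A \<in> borel_sets K"
  shows "total_variation K \<mu> A = (\<Sum>s\<in>A \<inter> S. \<bar>\<mu> {s}\<bar>)"
  unfolding total_variation_def positive_part_eq_sum[OF assms] negative_part_eq_sum[OF assms]
    sum.distrib[symmetric]
  by (intro sum.cong) auto

text \<open>Finite sets are closed, so \<open>A\<close> can be approximated from inside by
  \<open>A \<inter> S\<close> and from outside by the complement of \<open>S - A\<close>. Their
  difference misses \<open>S\<close> and has variation 0.\<close>

lemma regular: "\<mu> \<in> regular_measures K"
  unfolding regular_measures_def
proof (intro CollectI conjI sm ballI allI impI)
  fix A and e :: real
  assume A: "A \<in> borel_sets K" and "e > 0"
  let ?C = "A \<inter> S" and ?U = "topspace K - (S - A)"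
  have "closedin K ?C" "closedin K (S - A)"
    using t1 fin sub by (auto simp: t1_space_closedin_finite)
  moreover from this have "openin K ?U" by blast
  moreover have "total_variation K \<mu> (?U - ?C) = 0"
  proof -
    have "(?U - ?C) \<inter> S = {}" by blast
    moreover have "?U - ?C \<in> borel_sets K"
      using \<open>openin K ?U\<close> \<open>closedin K ?C\<close>
      by (intro borel_sets_Diff openin_in_borel_sets closedin_in_borel_sets)
    ultimately show ?thesis by (simp add: total_variation_eq_sum)
  qed
  ultimately show "\<exists>C U. closedin K C \<and> openin K U \<and> C \<subseteq> A \<and> A \<subseteq> U \<and>
      total_variation K \<mu> (U - C) < e"
    using \<open>e > 0\<close> borel_sets_subset[OF A] by (intro exI[of _ ?C] exI[of _ ?U]) auto
qed

end

section \<open>Integration against measures of finite support\<close>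

text \<open>The complement of \<open>S\<close> is a null set, so \<open>f\<close> may be replaced by
  a finite combination of indicators of points of \<open>S\<close>.\<close>

lemma integral_finite_sum_measure:
  assumes t1: "t1_space K" and fin: "finite S" and sub: "S \<subseteq> topspace K"
    and nonneg: "\<And>s. 0 \<le> w s"
    and p: "\<And>A. A \<in> borel_sets K \<Longrightarrow> p A = (\<Sum>s\<in>A \<inter> S. w s)"
    and f: "continuous_map K euclideanreal f"
  shows "integral\<^sup>L (measure_of (topspace K) (borel_sets K) (\<lambda>A. ennreal (p A))) f
    = (\<Sum>s\<in>S. w s * f s)"
proof -
  interpret B: sigma_algebra "topspace K" "borel_sets K"
    by (rule sigma_algebra_borel_sets)
  define M where "M = measure_of (topspace K) (borel_sets K) (\<lambda>A. ennreal (p A))"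
  have sets: "sets M = borel_sets K" and space: "space M = topspace K"
    by (simp_all add: M_def)
  \<comment> \<open>Summing over the fixed index set \<open>S\<close> reduces countable additivity
    of \<open>p\<close> to that of each indicator.\<close>
  have p': "p A = (\<Sum>s\<in>S. w s * indicator A s)" if "A \<in> borel_sets K" for A
    unfolding p[OF that] using fin
    by (intro sum.mono_neutral_cong_left) (auto simp: indicator_def)
  have em: "emeasure M A = ennreal (p A)" if "A \<in> borel_sets K" for A
  proof (rule emeasure_measure_of[OF M_def])
    show "positive (sets M) (\<lambda>A. ennreal (p A))"
      by (simp add: positive_def p)
    show "countably_additive (sets M) (\<lambda>A. ennreal (p A))"
    proof (rule countably_additiveI)
      fix A :: "nat \<Rightarrow> 'a set"
      assume A: "range A \<subseteq> sets M" "disjoint_family A" "(\<Union>i. A i) \<in> sets M"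
      have "(\<lambda>i. \<Sum>s\<in>S. w s * indicator (A i) s) sums (\<Sum>s\<in>S. w s * indicator (\<Union>i. A i) s)"
        using A(2) by (intro sums_sum sums_mult indicator_sums) (auto simp: disjoint_family_on_def)
      then have "(\<lambda>i. p (A i)) sums p (\<Union>i. A i)"
        using A by (simp add: p' sets range_subsetD)
      moreover have "0 \<le> p (A i)" for i
        using A nonneg by (simp add: p sets range_subsetD sum_nonneg)
      ultimately show "(\<Sum>i. ennreal (p (A i))) = ennreal (p (\<Union>i. A i))"
        by (intro suminf_ennreal_eq)
    qed
  qed (use that B.space_closed sets in auto)
  have sing: "{s} \<in> borel_sets K" if "s \<in> S" for s
    using finite_in_borel_sets[OF t1, of "{s}"] sub that by auto
  have ms: "measure M {s} = w s" if "s \<in> S" for s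
    using em[OF sing[OF that]] p[OF sing[OF that]] that nonneg by (simp add: measure_def)
  have "f \<in> borel_measurable M"
  proof (rule borel_measurableI)
    fix V :: "real set" assume "open V"
    then have "openin K {x \<in> topspace K. f x \<in> V}"
      using f by (intro openin_continuous_map_preimage) auto
    moreover have "{x \<in> topspace K. f x \<in> V} = f -` V \<inter> space M"
      by (auto simp: space)
    ultimately show "f -` V \<inter> space M \<in> sets M"
      using openin_in_borel_sets sets by metis
  qed
  moreover have int: "integrable M (\<lambda>x. indicator {s} x * f s)" if "s \<in> S" for s
    using em[OF sing[OF that]] sing[OF that]
    by (intro integrable_mult_left integrable_real_indicator) (auto simp: sets)
  moreover from int have "(\<lambda>x. \<Sum>s\<in>S. indicator {s} x * f s) \<in> borel_measurable M"
    by (intro borel_measurable_sum borel_measurable_integrable)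
  moreover have "AE x in M. f x = (\<Sum>s\<in>S. indicator {s} x * f s)"
  proof (rule AE_I)
    have S: "topspace K - S \<in> borel_sets K"
      using finite_in_borel_sets[OF t1 fin sub] by (intro borel_sets_Diff) auto
    show "topspace K - S \<in> sets M" by (simp add: sets S)
    have "(topspace K - S) \<inter> S = {}" by blast
    then show "emeasure M (topspace K - S) = 0"
      by (simp add: em[OF S] p[OF S])
    show "{x \<in> space M. f x \<noteq> (\<Sum>s\<in>S. indicator {s} x * f s)} \<subseteq> topspace K - S"
    proof -
      have "(\<Sum>s\<in>S. indicator {s} x * f s) = f x" if "x \<in> S" for x
        using fin that by (subst sum.remove[OF fin that]) (auto simp: indicator_def intro!: sum.neutral)
      then show ?thesis by (auto simp: space)
    qed
  qed
  ultimately have "integral\<^sup>L M f = integral\<^sup>L M (\<lambda>x. \<Sum>s\<in>S. indicator {s} x * f s)"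
    by (intro integral_cong_AE) auto
  also have "\<dots> = (\<Sum>s\<in>S. w s * f s)"
    using int sing by (subst Bochner_Integration.integral_sum)
      (auto intro!: sum.cong simp: ms sets space sub Int_absorb2 dest: borel_sets_subset)
  finally show ?thesis
    by (simp add: M_def)
qed

lemma (in finitely_supported) signed_integral_eq_sum:
  assumes "continuous_map K euclideanreal f"
  shows "signed_integral K \<mu> f = (\<Sum>s\<in>S. \<mu> {s} * f s)"
proof -
  have "signed_integral K \<mu> f
      = (\<Sum>s\<in>S. max 0 (\<mu> {s}) * f s) - (\<Sum>s\<in>S. max 0 (- \<mu> {s}) * f s)"
    unfolding signed_integral_def using t1 fin sub assms
    by (intro arg_cong2[where f = "(-)"] integral_finite_sum_measure)
      (auto simp: positive_part_eq_sum negative_part_eq_sum)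
  also have "\<dots> = (\<Sum>s\<in>S. \<mu> {s} * f s)"
    unfolding sum_subtractf[symmetric] by (intro sum.cong) (auto simp: max_def)
  finally show ?thesis .
qed

section \<open>Three-point measures and their compensations\<close>

text \<open>This is (delta_y + delta_z - delta_x) / 3, where the factor 1/3 keeps the total
  variation at most 1. The argument \<open>z\<close> comes last since it is the one that
  varies.\<close>

definition three_point_measure :: "'a topology \<Rightarrow> 'a \<Rightarrow> 'a \<Rightarrow> 'a \<Rightarrow> 'a set \<Rightarrow> real" where
  "three_point_measure K x y z A =
     (if A \<in> borel_sets K then (indicator A y + indicator A z - indicator A x) / 3 else 0)"

lemma finitely_supported_three_point_measure:
  assumes "t1_space K" "x \<in> topspace K" "y \<in> topspace K" "z \<in> topspace K"
  shows "finitely_supported K (three_point_measure K x y z) {x, y, z}"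
proof
  show "signed_measure K (three_point_measure K x y z)"
    unfolding signed_measure_def
  proof (intro conjI allI impI)
    fix A :: "nat \<Rightarrow> 'a set"
    assume A: "range A \<subseteq> borel_sets K" "disjoint_family A"
    then have "(\<Union>n. A n) \<in> borel_sets K"
      using sigma_algebra.countable_UN[OF sigma_algebra_borel_sets] by blast
    moreover have "(\<lambda>n. (indicator (A n) y + indicator (A n) z - indicator (A n) x) / 3 :: real)
        sums ((indicator (\<Union>n. A n) y + indicator (\<Union>n. A n) z - indicator (\<Union>n. A n) x) / 3)"
      using A(2) by (intro sums_divide sums_add sums_diff indicator_sums)
        (auto simp: disjoint_family_on_def)
    ultimately show "(\<lambda>n. three_point_measure K x y z (A n)) sums
        three_point_measure K x y z (\<Union>n. A n)"
      using A(1) by (simp add: three_point_measure_def range_subsetD)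
  qed (auto simp: three_point_measure_def)
qed (use assms in \<open>auto simp: three_point_measure_def\<close>)

context
  fixes K :: "'a topology" and x y z :: 'a
  assumes t1: "t1_space K" and x: "x \<in> topspace K" and y: "y \<in> topspace K" and z: "z \<in> topspace K"
begin

interpretation finitely_supported K "three_point_measure K x y z" "{x, y, z}"
  by (rule finitely_supported_three_point_measure) (fact t1 x y z)+

lemma three_point_measure_singleton:
  "s \<in> {x, y, z} \<Longrightarrow> three_point_measure K x y z {s} =
     (of_bool (s = y) + of_bool (s = z) - of_bool (s = x)) / 3"
proof -
  assume "s \<in> {x, y, z}"
  then have "{s} \<in> borel_sets K"
    by (intro subset_borel) simp
  then show ?thesis
    by (simp add: three_point_measure_def indicator_def of_bool_def eq_commute[of s])
qed

lemma three_point_measure_in_unit_ball: "three_point_measure K x y z \<in> measures_unit_ball K"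
proof -
  have "topspace K \<inter> {x, y, z} = {x, y, z}"
    using x y z by blast
  then have "total_variation K (three_point_measure K x y z) (topspace K)
      = (\<Sum>s\<in>{x, y, z}. \<bar>(of_bool (s = y) + of_bool (s = z) - of_bool (s = x)) / 3\<bar>)"
    unfolding total_variation_eq_sum[OF topspace_in_borel_sets]
    by (simp only: three_point_measure_singleton cong: sum.cong)
  also have "\<dots> \<le> 1"
    \<comment> \<open>When points coincide, the index set \<open>{x, y, z}\<close> shrinks and the
      masses merge or cancel, hence the case distinction.\<close>
    by (cases "x = y"; cases "x = z"; cases "y = z") (simp_all add: insert_commute)
  finally have "total_variation K (three_point_measure K x y z) (topspace K) \<le> 1" .
  then show ?thesis
    by (simp add: measures_unit_ball_def regular)
qed

lemma signed_integral_three_point_measure: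
  assumes "continuous_map K euclideanreal f"
  shows "signed_integral K (three_point_measure K x y z) f = (f y + f z - f x) / 3"
proof -
  have "signed_integral K (three_point_measure K x y z) f
      = (\<Sum>s\<in>{x, y, z}. (of_bool (s = y) + of_bool (s = z) - of_bool (s = x)) / 3 * f s)"
    unfolding signed_integral_eq_sum[OF assms]
    by (simp only: three_point_measure_singleton cong: sum.cong)
  also have "\<dots> = (f y + f z - f x) / 3"
    by (cases "x = y"; cases "x = z"; cases "y = z") (simp_all add: field_simps insert_commute)
  finally show ?thesis .
qed

text \<open>A compensation is dominated by the positive part, which lives on \<open>{y, z}\<close>.
  For \<open>x = z\<close> the masses at \<open>z\<close> cancel, so nothing is left there; this is
  the limit case at infinity.\<close>

lemma finitely_supported_compensation:
  assumes \<nu>: "compensation_of K (three_point_measure K x y z) \<nu>"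
    and "x \<noteq> y" "y \<noteq> z"
  shows "finitely_supported K \<nu> {y, z}" "\<nu> {y} + \<nu> {z} = 1 / 3" "x = z \<Longrightarrow> \<nu> {z} = 0"
proof -
  let ?\<mu> = "three_point_measure K x y z"
  \<comment> \<open>A positive total mass rules out the branch in which the compensation is
    0.\<close>
  have "?\<mu> (topspace K) = 1 / 3"
    using x y z by (simp add: three_point_measure_def)
  then have c: "\<nu> \<in> regular_measures K" "\<nu> (topspace K) = 1 / 3"
      "\<And>A. A \<in> borel_sets K \<Longrightarrow> 0 \<le> \<nu> A \<and> \<nu> A \<le> positive_part K ?\<mu> A"
    using \<nu> by (auto simp: compensation_of_def split: if_splits)
  have le: "\<nu> A \<le> (\<Sum>s\<in>A \<inter> {x, y, z}. max 0 (?\<mu> {s}))" if "A \<in> borel_sets K" for A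
    using c(3)[OF that] positive_part_eq_sum[OF that] by simp
  have vanish: "\<nu> A = 0" if A: "A \<in> borel_sets K" "A \<inter> {y, z} = {}" for A
  proof -
    have "(\<Sum>s\<in>A \<inter> {x, y, z}. max 0 (?\<mu> {s})) = 0"
      using A(2) by (intro sum.neutral) (auto simp: three_point_measure_singleton)
    then show ?thesis
      using le[OF A(1)] c(3)[OF A(1)] by linarith
  qed
  show N: "finitely_supported K \<nu> {y, z}"
    using t1 y z c(1) vanish by unfold_locales (auto simp: regular_measures_def)
  have "topspace K \<inter> {y, z} = {y, z}"
    using y z by blast
  then show "\<nu> {y} + \<nu> {z} = 1 / 3"
    using finitely_supported.measure_eq_sum[OF N topspace_in_borel_sets] c(2) \<open>y \<noteq> z\<close> by simp
  show "\<nu> {z} = 0" if "x = z"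
  proof -
    have z': "{z} \<in> borel_sets K" by (rule subset_borel) simp
    have "?\<mu> {z} = 0"
      using three_point_measure_singleton[of z] that \<open>y \<noteq> z\<close> by simp
    then have "\<nu> {z} \<le> 0"
      using le[OF z'] by simp
    then show ?thesis using c(3)[OF z'] by linarith
  qed
qed

end

subsection \<open>Weak-star continuity\<close>

lemma continuous_map_signed_integral:
  assumes "continuous_map K euclideanreal f"
  shows "continuous_map (weak_star K) euclideanreal (\<lambda>\<mu>. signed_integral K \<mu> f)"
proof -
  let ?F = "{f. continuous_map K euclideanreal f}"
  have "continuous_map (weak_star K) (product_topology (\<lambda>_. euclideanreal) ?F)
      ((\<lambda>g. g) \<circ> (\<lambda>\<mu>. \<lambda>f\<in>?F. signed_integral K \<mu> f))"
    unfolding weak_star_def by (rule continuous_map_pullback) (rule continuous_map_id[unfolded id_def])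
  from continuous_map_compose[OF this continuous_map_product_projection[of f]]
  show ?thesis
    using assms by (simp add: o_def)
qed

text \<open>This is the universal property of the initial topology: continuity is tested on the
  integrals of continuous functions.\<close>

lemma continuous_map_into_weak_star:
  assumes "\<And>t. t \<in> topspace X \<Longrightarrow> \<Phi> t \<in> regular_measures K"
    and "\<And>f. continuous_map K euclideanreal f \<Longrightarrow>
      continuous_map X euclideanreal (\<lambda>t. signed_integral K (\<Phi> t) f)"
  shows "continuous_map X (weak_star K) \<Phi>"
  unfolding weak_star_def
proof (rule continuous_map_pullback')
  show "topspace X \<subseteq> \<Phi> -` regular_measures K"
    using assms(1) by blast
  show "continuous_map X (product_topology (\<lambda>_. euclideanreal) {f. continuous_map K euclideanreal f})
      ((\<lambda>\<mu>. \<lambda>f\<in>{f. continuous_map K euclideanreal f}. signed_integral K \<mu> f) \<circ> \<Phi>)"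
    using assms(2) by (auto simp: continuous_map_componentwise o_def)
qed

lemma continuous_map_three_point_measure:
  assumes t1: "t1_space K" and "x \<in> topspace K" "y \<in> topspace K"
  shows "continuous_map K (subtopology (weak_star K) (measures_unit_ball K)) (three_point_measure K x y)"
  unfolding continuous_map_in_subtopology
proof
  show "continuous_map K (weak_star K) (three_point_measure K x y)"
  proof (rule continuous_map_into_weak_star)
    show "three_point_measure K x y z \<in> regular_measures K" if "z \<in> topspace K" for z
      using three_point_measure_in_unit_ball[OF assms that] by (simp add: measures_unit_ball_def)
    fix f assume f: "continuous_map K euclideanreal f"
    have "continuous_map K euclideanreal (\<lambda>z. (f y + f z - f x) / 3)"
      by (intro continuous_intros f) auto
    then show "continuous_map K euclideanreal (\<lambda>z. signed_integral K (three_point_measure K x y z) f)"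
      by (rule continuous_map_eq) (simp add: signed_integral_three_point_measure[OF assms _ f])
  qed
  show "three_point_measure K x y \<in> topspace K \<rightarrow> measures_unit_ball K"
    using three_point_measure_in_unit_ball[OF assms] by blast
qed

text \<open>Applied to an isolated point, this makes the integral of its indicator a weak-star
  continuous functional, through which the mass at that point is read off.\<close>

lemma continuous_map_indicator_clopen:
  assumes "openin K U" "closedin K U"
  shows "continuous_map K euclideanreal (indicator U)"
  unfolding continuous_map_def
proof (intro conjI allI impI)
  fix V :: "real set"
  have "{t \<in> topspace K. indicator U t \<in> V} =
      (if 1 \<in> V then U else {}) \<union> (if 0 \<in> V then topspace K - U else {})"
    using openin_subset[OF assms(1)] by (auto simp: indicator_def split: if_splits)
  then show "openin K {t \<in> topspace K. indicator U t \<in> V}"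
    using assms by auto
qed simp

section \<open>Nonexistence of a compensation function\<close>

lemma no_ball_compensation_function:
  assumes "uncountable \<Gamma>"
  shows "\<not> ball_compensation_function (A_compact \<Gamma>) \<xi>"
proof
  let ?K = "A_compact \<Gamma>"
  assume \<xi>: "ball_compensation_function ?K \<xi>"
  have t1: "t1_space ?K" by (rule t1_space_A_compact)
  \<comment> \<open>As an integral, \<open>g y\<close> is continuous on the whole space. It is
    identified with the mass at \<open>Some y\<close> only for \<open>t \<noteq> Some y\<close>,
    where the description of compensations applies.\<close>
  define g where "g y t = signed_integral ?K (\<xi> (three_point_measure ?K None (Some y) t)) (indicator {Some y})"
    for y t
  have ind: "continuous_map ?K euclideanreal (indicator {Some y})" if "y \<in> \<Gamma>" for y
  proof (rule continuous_map_indicator_clopen)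
    have "openin ?K (Some ` {y})"
      unfolding openin_Alexandroff_compactification_image_Some using that by simp
    then show "openin ?K {Some y}" by simp
    show "closedin ?K {Some y}"
      using t1 that by (intro closedin_t1_singleton) auto
  qed
  have comp: "compensation_of ?K (three_point_measure ?K None (Some y) t)
      (\<xi> (three_point_measure ?K None (Some y) t))"
    if "y \<in> \<Gamma>" "t \<in> topspace ?K" for y t
    using \<xi> three_point_measure_in_unit_ball[OF t1, of None "Some y" t] that
    by (auto simp: ball_compensation_function_def)
  have g: "g y t = \<xi> (three_point_measure ?K None (Some y) t) {Some y}"
    if y: "y \<in> \<Gamma>" and t: "t \<in> topspace ?K" and "t \<noteq> Some y" for y t
  proof -
    have "finitely_supported ?K (\<xi> (three_point_measure ?K None (Some y) t)) {Some y, t}"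
      using finitely_supported_compensation(1)[OF t1 _ _ t comp[OF y t]] that by auto
    note finitely_supported.signed_integral_eq_sum[OF this ind[OF y]]
    then show ?thesis
      using \<open>t \<noteq> Some y\<close> by (simp add: g_def indicator_def)
  qed
  \<comment> \<open>The threshold 1/6 is half of the total mass 1/3, so two distinct points cannot
    both carry more.\<close>
  define U where "U y = {t \<in> topspace ?K. g y t \<in> {1/6<..}}" for y
  have U: "openin ?K (U y) \<and> None \<in> U y" if y: "y \<in> \<Gamma>" for y
  proof
    have "continuous_map ?K (weak_star ?K) (\<xi> \<circ> three_point_measure ?K None (Some y))"
      using \<xi> y continuous_map_three_point_measure[OF t1, of None "Some y"]
      by (intro continuous_map_compose) (auto simp: ball_compensation_function_def)
    from continuous_map_compose[OF this continuous_map_signed_integral[OF ind[OF y]]]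
    have "continuous_map ?K euclideanreal (g y)"
      by (simp add: o_def g_def[abs_def])
    then show "openin ?K (U y)"
      unfolding U_def by (rule openin_continuous_map_preimage) simp
    let ?\<nu> = "\<xi> (three_point_measure ?K None (Some y) None)"
    \<comment> \<open>At \<open>t = None\<close> the terms at infinity cancel and leave a third of
      the point mass at \<open>Some y\<close>, so the whole mass 1/3 sits there.\<close>
    have "?\<nu> {Some y} + ?\<nu> {None} = 1/3" "?\<nu> {None} = 0"
      using finitely_supported_compensation(2,3)[OF t1 _ _ _ comp[OF y, of None]] y by auto
    then show "None \<in> U y"
      using g[OF y, of None] by (simp add: U_def)
  qed
  obtain y z where yz: "y \<in> \<Gamma>" "z \<in> \<Gamma>" "y \<noteq> z" "Some z \<in> U y" "Some y \<in> U z"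
    using nbhds_infinity_mutual_pair[of \<Gamma> U] assms U by blast
  \<comment> \<open>By this symmetry \<open>g y (Some z)\<close> and \<open>g z (Some y)\<close> are
    masses of one and the same compensation at two distinct points.\<close>
  have "three_point_measure ?K None (Some y) (Some z) = three_point_measure ?K None (Some z) (Some y)"
    by (auto simp: three_point_measure_def fun_eq_iff)
  moreover have "\<xi> (three_point_measure ?K None (Some y) (Some z)) {Some y}
      + \<xi> (three_point_measure ?K None (Some y) (Some z)) {Some z} = 1/3"
    using yz by (intro finitely_supported_compensation(2)[OF t1 _ _ _ comp]) auto
  ultimately show False
    using yz g[of y "Some z"] g[of z "Some y"] by (auto simp: U_def)
qed

theorem corollary4p7:
  fixes \<Gamma> :: "'a set"
  assumes "uncountable \<Gamma>"
  shows "(\<nexists>c. closeness_function (Alexandroff_compactification (discrete_topology \<Gamma>)) c) \<and>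
         (\<nexists>\<xi>. ball_compensation_function (Alexandroff_compactification (discrete_topology \<Gamma>)) \<xi>)"
  using no_closeness_function[OF assms] no_ball_compensation_function[OF assms] by blast

end
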